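(* Let $X$ be a topological space. The following are equivalent: (1) $X$ is semi-connected. (2) $X$ is not the union of two disjoint non-empty $\mathcal{AB}$-sets.
   Context: For a subset $A$ of a topological space $X$, $\mathrm{Int}\,A$ denotes the interior and $\overline{A}$ the closure of $A$ in $X$. $A$ is semi-open if $A \subseteq \overline{\mathrm{Int}\,A}$; semi-closed if its complement is semi-open; semi-regular if it is both semi-open and semi-closed. $A$ is an $\mathcal{AB}$-set if $A = U \cap V$ with $U$ open and $V$ semi-regular. A space $X$ is semi-connected if $X$ cannot be expressed as the disjoint union of two non-empty semi-open sets. No separation axioms are assumed. *)

theory Defs
  imports "HOL-Analysis.Analysis"
begin

text \<open>
  Spaces are abstract topologies with carrier \<^term>\<open>topspace X\<close>, which may be empty.
  Closures lie in the carrier, so a semi-open set is automatically a subset of it; for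
  semi-closed sets this has to be required, as the complement is taken in the carrier.
\<close>

definition semi_open_in :: "'a topology \<Rightarrow> 'a set \<Rightarrow> bool" where
  "semi_open_in X A \<longleftrightarrow> A \<subseteq> X closure_of (X interior_of A)"

definition semi_closed_in :: "'a topology \<Rightarrow> 'a set \<Rightarrow> bool" where
  "semi_closed_in X A \<longleftrightarrow> A \<subseteq> topspace X \<and> semi_open_in X (topspace X - A)"

definition semi_regular_in :: "'a topology \<Rightarrow> 'a set \<Rightarrow> bool" where
  "semi_regular_in X A \<longleftrightarrow> semi_open_in X A \<and> semi_closed_in X A"

definition AB_set_in :: "'a topology \<Rightarrow> 'a set \<Rightarrow> bool" where
  "AB_set_in X A \<longleftrightarrow> (\<exists>U V. openin X U \<and> semi_regular_in X V \<and> A = U \<inter> V)"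

definition semi_connected_space :: "'a topology \<Rightarrow> bool" where
  "semi_connected_space X \<longleftrightarrow>
    \<not> (\<exists>A B. semi_open_in X A \<and> semi_open_in X B \<and> A \<noteq> {} \<and> B \<noteq> {} \<and>
          A \<inter> B = {} \<and> topspace X = A \<union> B)"

end

theory Submission
  imports Defs
begin

text \<open>For a partition of the space into two sets, both parts are AB-sets exactly when both are
  semi-open. Every AB-set is semi-open, since cutting a semi-open set with an open one preserves
  semi-openness (\<open>semi_open_in_Int_openin\<close>). Conversely, in a semi-open partition each
  part has semi-open complement, so it is semi-regular and hence an AB-set.\<close>

lemma semi_open_in_Int_openin:
  assumes "openin X U" "semi_open_in X V"
  shows "semi_open_in X (U \<inter> V)"
proof -
  have "U \<inter> V \<subseteq> U \<inter> X closure_of (X interior_of V)"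
    using assms(2) by (auto simp: semi_open_in_def)
  \<comment> \<open>\<open>U\<close> is a neighbourhood of each of its points, so closeness to a set
    can be tested inside \<open>U\<close>.\<close>
  also have "\<dots> \<subseteq> X closure_of (U \<inter> X interior_of V)"
    using assms(1) by (rule openin_Int_closure_of_subset)
  also have "U \<inter> X interior_of V = X interior_of (U \<inter> V)"
    using assms(1) by (simp add: interior_of_Int interior_of_openin)
  finally show ?thesis
    by (simp add: semi_open_in_def)
qed

lemma AB_set_in_imp_semi_open_in: "AB_set_in X A \<Longrightarrow> semi_open_in X A"
  by (auto simp: AB_set_in_def semi_regular_in_def intro: semi_open_in_Int_openin)

lemma semi_regular_in_imp_AB_set_in:
  assumes "semi_regular_in X A"
  shows "AB_set_in X A"
proof -
  \<comment> \<open>The whole space serves as the open factor.\<close>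
  have "A = topspace X \<inter> A"
    using assms by (auto simp: semi_regular_in_def semi_closed_in_def)
  then show ?thesis
    using assms openin_topspace unfolding AB_set_in_def by blast
qed

lemma semi_open_partition_imp_semi_regular_in:
  assumes "semi_open_in X A" "semi_open_in X B" "A \<inter> B = {}" "topspace X = A \<union> B"
  shows "semi_regular_in X A"
proof -
  have "topspace X - A = B"
    using assms by blast
  then show ?thesis
    using assms by (simp add: semi_regular_in_def semi_closed_in_def)
qed

theorem theorem3p7:
  fixes X :: "'a topology"
  shows "semi_connected_space X \<longleftrightarrow>
    \<not> (\<exists>A B. AB_set_in X A \<and> AB_set_in X B \<and> A \<noteq> {} \<and> B \<noteq> {} \<and>
          A \<inter> B = {} \<and> topspace X = A \<union> B)"
proof -
  \<comment> \<open>The equivalence concerns the pair: semi-regularity of either part uses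
    semi-openness of the other, hence the two instances with roles swapped.\<close>
  have "AB_set_in X A \<and> AB_set_in X B \<longleftrightarrow> semi_open_in X A \<and> semi_open_in X B"
    if "A \<inter> B = {}" "topspace X = A \<union> B" for A B
    using that semi_open_partition_imp_semi_regular_in[of X A B]
      semi_open_partition_imp_semi_regular_in[of X B A]
    by (auto simp: Int_commute Un_commute
        intro: AB_set_in_imp_semi_open_in semi_regular_in_imp_AB_set_in)
  then show ?thesis
    unfolding semi_connected_space_def by blast
qed

end
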